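(* Fix $N\in\mathbb{N}$. Let $\theta\in(0,1]$, $(a_n)_{n=1}^\infty=\mathcal{G}(\theta)$, and $e_m=\theta-\sum_{n=1}^m 1/a_n$ for $m\geqslant 0$. Let $m\geqslant 1$ and let $N/b_m$ (with $b_m\in\mathbb{N}$) be the largest fraction with numerator $N$ and positive integer denominator that is strictly smaller than $e_{m-1}$. The following are equivalent: i) $a_{m+1}\geqslant N a_m^2-a_m+1$; ii) $1/a_m=N/b_m$; iii) $\Phi(e_{m-1})\geqslant N$; iv) $e_{m-1}\leqslant N/(Na_m-1)$.
   Context: $\mathbb{N}$ is the set of positive integers. For $\theta\in(0,1]$ let $G(\theta)=\lfloor 1/\theta\rfloor+1$. The greedy algorithm $\mathcal{G}$ produces the sequence $\mathcal{G}(\theta)=(a_n)_{n=1}^\infty$ of positive integers defined by $a_1=G(\theta)$ and $a_m=G\left(\theta-\sum_{n=1}^{m-1}1/a_n\right)$ for $m\geqslant 2$. The function $\Phi:(0,1]\to[1,\infty)$ is defined by $\Phi(\theta)=\frac{1}{1-\{\theta^{-1}\}}=\frac{1}{G(\theta)-1/\theta}$, where $\{x\}=x-\lfloor x\rfloor$. *)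

theory Defs
  imports Complex_Main
begin

text \<open>
  The functions below are meant for arguments in the half-open interval from 0 (excluded)
  to 1 (included); sequences are indexed from 1.
\<close>

definition greedy_G :: "real \<Rightarrow> nat" where
  "greedy_G \<theta> = nat \<lfloor>1 / \<theta>\<rfloor> + 1"

text \<open>
  The case \<open>m = 1\<close> has an empty sum, giving \<open>a\<^sub>1 = G(\<theta>)\<close>. The value at index 0
  is junk and never enters a sum.
\<close>
function greedy :: "real \<Rightarrow> nat \<Rightarrow> nat" where
  "greedy \<theta> m = greedy_G (\<theta> - (\<Sum>n = 1..<m. 1 / real (greedy \<theta> n)))"
  by auto
termination by (relation "measure snd") auto

declare greedy.simps [simp del]

definition greedy_error :: "real \<Rightarrow> nat \<Rightarrow> real" where
  "greedy_error \<theta> m = \<theta> - (\<Sum>n = 1..m. 1 / real (greedy \<theta> n))"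

definition greedy_Phi :: "real \<Rightarrow> real" where
  "greedy_Phi \<theta> = 1 / (1 - frac (1 / \<theta>))"

lemma greedy_Phi_eq:
  assumes "0 < \<theta>"
  shows "greedy_Phi \<theta> = 1 / (real (greedy_G \<theta>) - 1 / \<theta>)"
  using assms by (simp add: greedy_Phi_def greedy_G_def frac_def algebra_simps)

definition largest_fraction_below :: "nat \<Rightarrow> real \<Rightarrow> nat \<Rightarrow> bool" where
  "largest_fraction_below N x b \<longleftrightarrow>
     b \<ge> 1 \<and> real N / real b < x \<and>
     (\<forall>c::nat. c \<ge> 1 \<longrightarrow> real N / real c < x \<longrightarrow> real N / real c \<le> real N / real b)"

lemma ex_largest_fraction_below:
  assumes "0 < x"
  shows "\<exists>b. largest_fraction_below N x b"
proof -
  define P where "P = (\<lambda>c::nat. c \<ge> 1 \<and> real N / real c < x)"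
  obtain k :: nat where "real N / x < real k" using reals_Archimedean2 by blast
  then have "P (Suc k)"
    using assms by (simp add: P_def field_simps)
  then have "P (Least P)" "\<And>c. P c \<Longrightarrow> Least P \<le> c"
    by (auto intro: LeastI Least_le)
  then have "largest_fraction_below N x (Least P)"
    unfolding largest_fraction_below_def P_def by (auto intro!: divide_left_mono)
  then show ?thesis ..
qed

end

theory Submission
  imports Defs
begin

text \<open>
  Put \<open>x = e\<^sub>m\<^sub>-\<^sub>1\<close> and \<open>g = a\<^sub>m = G(x)\<close>. Each of the four conditions rearranges to
  \<open>x(Ng - 1) \<le> N\<close>. For (i), \<open>a\<^sub>m\<^sub>+\<^sub>1 = G(x - 1/g)\<close> exceeds the integer \<open>Ng\<^sup>2 - g\<close> iff
  \<open>(Ng\<^sup>2 - g)(x - 1/g) \<le> 1\<close>. For (ii), the largest \<open>N/b < x\<close> has \<open>b\<close> minimal, and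
  \<open>N/(Ng) < x\<close> always holds, so \<open>b = Ng\<close> iff \<open>N/(Ng - 1)\<close> is not below \<open>x\<close>.
\<close>

text \<open>\<open>greedy_G x\<close> - 1 is the floor of 1/x, and an integer is at most this floor
  iff it is at most 1/x. Letting k be an integer avoids truncated subtraction in condition
  (i).\<close>

lemma less_greedy_G_iff:
  assumes "0 < x"
  shows "k < int (greedy_G x) \<longleftrightarrow> of_int k * x \<le> 1"
proof -
  have "k < int (greedy_G x) \<longleftrightarrow> k \<le> \<lfloor>1 / x\<rfloor>"
    using assms by (simp add: greedy_G_def) linarith
  also have "\<dots> \<longleftrightarrow> of_int k * x \<le> 1"
    using assms by (simp add: le_floor_iff pos_le_divide_eq)
  finally show ?thesis .
qed

text \<open>The case k = G(x) of the equivalence above, whose left side is then false.\<close>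

lemma inverse_greedy_G_less:
  assumes "0 < x"
  shows "1 / real (greedy_G x) < x"
proof -
  have "0 < greedy_G x"
    by (simp add: greedy_G_def)
  with less_greedy_G_iff[OF assms, of "int (greedy_G x)"] show ?thesis
    by (simp add: field_simps)
qed

text \<open>Keeps the denominator Ng - 1 positive even for N = 1.\<close>

lemma greedy_G_ge_2:
  assumes "0 < x" "x \<le> 1"
  shows "2 \<le> greedy_G x"
  using less_greedy_G_iff[of x 1] assms by simp

lemma greedy_Suc: "greedy \<theta> (Suc m) = greedy_G (greedy_error \<theta> m)"
  by (subst greedy.simps) (simp add: greedy_error_def atLeastLessThanSuc_atLeastAtMost)

lemma greedy_error_0: "greedy_error \<theta> 0 = \<theta>"
  by (simp add: greedy_error_def)

lemma greedy_error_Suc: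
  "greedy_error \<theta> (Suc m) = greedy_error \<theta> m - 1 / real (greedy_G (greedy_error \<theta> m))"
  unfolding greedy_Suc[symmetric] by (simp add: greedy_error_def)

lemma greedy_error_pos:
  assumes "0 < \<theta>"
  shows "0 < greedy_error \<theta> m"
  by (induction m)
    (use assms inverse_greedy_G_less in \<open>simp_all add: greedy_error_0 greedy_error_Suc\<close>)

lemma greedy_error_le: "greedy_error \<theta> m \<le> \<theta>"
  by (simp add: greedy_error_def sum_nonneg)

lemma largest_fraction_below_eq_iff:
  assumes "largest_fraction_below N x b" "1 \<le> N" "2 \<le> c" "real N / real c < x"
  shows "b = c \<longleftrightarrow> x \<le> real N / (real c - 1)"
proof
  assume "b = c"
  show "x \<le> real N / (real c - 1)"
  proof (rule ccontr)
    assume "\<not> ?thesis"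
    \<comment> \<open>Since c \<ge> 2, the denominator c - 1 is admissible and maximality applies to
      it, yet N/(c - 1) > N/c.\<close>
    then have "real N / real (c - 1) < x"
      using assms(3) by (simp add: of_nat_diff)
    moreover have "1 \<le> c - 1"
      using assms(3) by simp
    ultimately have "real N / real (c - 1) \<le> real N / real c"
      using assms(1) \<open>b = c\<close> unfolding largest_fraction_below_def by blast
    then show False
      using assms by (simp add: field_simps of_nat_diff)
  qed
next
  assume le: "x \<le> real N / (real c - 1)"
  \<comment> \<open>As N/c < x, c competes with b, hence b \<le> c; and b \<le> c - 1 would give N/b
    \<ge> N/(c - 1) \<ge> x.\<close>
  have b: "1 \<le> b" "real N / real b < x" "real N / real c \<le> real N / real b"
    using assms by (auto simp: largest_fraction_below_def)
  have "real b \<le> real c"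
    using b assms by (simp add: field_simps)
  moreover have "real N / real b < real N / (real c - 1)"
    using b le by linarith
  then have "real c - 1 < real b"
    by (rule contrapos_pp) (use b assms in \<open>auto simp: not_less intro!: divide_left_mono\<close>)
  ultimately show "b = c" by linarith
qed

theorem theorem1p5:
  fixes N m b :: nat and \<theta> :: real and a :: "nat \<Rightarrow> nat" and e :: "nat \<Rightarrow> real"
  assumes N: "N \<ge> 1"
    and \<theta>: "0 < \<theta>" "\<theta> \<le> 1"
    and a: "a = greedy \<theta>"
    and e: "e = greedy_error \<theta>"
    and m: "m \<ge> 1"
    and b: "largest_fraction_below N (e (m - 1)) b"
  shows "(int (a (m + 1)) \<ge> int N * (int (a m))\<^sup>2 - int (a m) + 1
           \<longleftrightarrow> 1 / real (a m) = real N / real b)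
       \<and> (1 / real (a m) = real N / real b
           \<longleftrightarrow> greedy_Phi (e (m - 1)) \<ge> real N)
       \<and> (greedy_Phi (e (m - 1)) \<ge> real N
           \<longleftrightarrow> e (m - 1) \<le> real N / (real N * real (a m) - 1))"
proof -
  obtain k where k: "m = Suc k"
    using m by (cases m) auto
  define x where "x = e (m - 1)"
  define g where "g = greedy_G x"
  have am: "a m = g"
    by (simp add: a e k x_def g_def greedy_Suc)
  have aSm: "a (m + 1) = greedy_G (x - 1 / real g)"
    by (simp add: a e k x_def g_def greedy_Suc greedy_error_Suc)
  have x: "0 < x" "x \<le> 1"
    using greedy_error_pos[OF \<theta>(1)] greedy_error_le[of \<theta> k] \<theta>(2) by (auto simp: x_def e k)
  have g2: "2 \<le> g"
    unfolding g_def using x by (rule greedy_G_ge_2)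
  have gx: "1 / real g < x"
    unfolding g_def using x(1) by (rule inverse_greedy_G_less)
  have "2 \<le> N * g"
    using mult_le_mono[OF N g2] by simp
  then have Ng: "0 < real N * real g - 1"
    by (simp flip: of_nat_mult)
  have iv: "x \<le> real N / (real N * real g - 1) \<longleftrightarrow> x * (real N * real g - 1) \<le> real N"
    using Ng by (simp add: pos_le_divide_eq)
  \<comment> \<open>Over the integers k + 1 \<le> \<open>a (m + 1)\<close> means k <
    \<open>a (m + 1)\<close>, here with k = Ng^2 - g; \<open>gx\<close> makes the next remainder x -
    1/g positive.\<close>
  have "int (a (m + 1)) \<ge> int N * (int g)\<^sup>2 - int g + 1 \<longleftrightarrow>
      (real N * (real g)\<^sup>2 - real g) * (x - 1 / real g) \<le> 1"
    using less_greedy_G_iff[of "x - 1 / real g" "int N * (int g)\<^sup>2 - int g"] gx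
    unfolding aSm by simp linarith
  \<comment> \<open>The product is (Ng - 1)(gx - 1); splitting off 1 leaves a multiple of g > 0
    whose sign decides.\<close>
  also have "(real N * (real g)\<^sup>2 - real g) * (x - 1 / real g)
      = real g * (x * (real N * real g - 1) - real N) + 1"
    using g2 by (simp add: field_simps power2_eq_square)
  also have "\<dots> \<le> 1 \<longleftrightarrow> x * (real N * real g - 1) \<le> real N"
    using g2 by (simp add: mult_le_0_iff)
  finally have i: "int (a (m + 1)) \<ge> int N * (int g)\<^sup>2 - int g + 1 \<longleftrightarrow>
      x \<le> real N / (real N * real g - 1)"
    by (simp only: iv)
  have "b \<ge> 1"
    using b by (simp add: largest_fraction_below_def)
  then have "1 / real g = real N / real b \<longleftrightarrow> real b = real (N * g)"
    using g2 by (auto simp: field_simps)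
  also have "\<dots> \<longleftrightarrow> b = N * g"
    by (rule of_nat_eq_iff)
  \<comment> \<open>With c = Ng, the requirement N/c < x is just 1/g < x.\<close>
  finally have ii: "1 / real g = real N / real b \<longleftrightarrow> x \<le> real N / (real N * real g - 1)"
    using largest_fraction_below_eq_iff[OF b N \<open>2 \<le> N * g\<close>] gx N by (simp add: x_def)
  \<comment> \<open>This is the denominator of \<open>greedy_Phi x\<close>; once it is cleared,
    multiplying by x > 0 gives the common inequality.\<close>
  have "0 < real g - 1 / x"
    using gx x g2 by (simp add: field_simps)
  then have "real N \<le> greedy_Phi x \<longleftrightarrow> real N * (real g - 1 / x) \<le> 1"
    using x by (simp add: greedy_Phi_eq pos_le_divide_eq flip: g_def)
  also have "\<dots> \<longleftrightarrow> x * (real N * real g - 1) \<le> real N"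
    using x by (simp add: field_simps)
  finally have iii: "real N \<le> greedy_Phi x \<longleftrightarrow> x \<le> real N / (real N * real g - 1)"
    by (simp only: iv)
  show ?thesis
    unfolding am x_def[symmetric] using i ii iii by blast
qed

end
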